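(* Let $\mathcal{C}$ be a clutter with vertex set $\{x_1,\ldots,x_n\}$, let $I(\mathcal{C})$ be its edge ideal, and let $\alpha=(a_1,\ldots,a_n,b)$ be a vector in $\{0,1\}^n\times\mathbb{N}$. Then $\alpha$ is in the Hilbert basis of the Simis cone ${\rm Cn}(I(\mathcal{C}))$ if and only if the induced subclutter $H=\mathcal{C}[\{x_i\mid a_i=1\}]$ is indecomposable with $b=\alpha_0(H)$.
   Context: $\mathbb{N}=\{0,1,2,\ldots\}$. A clutter $\mathcal{C}$ with finite nonempty vertex set $V(\mathcal{C})=\{x_1,\ldots,x_n\}$ is a family $E(\mathcal{C})$ of nonempty subsets of $V(\mathcal{C})$, called edges, none of which is included in another (the family may be empty). Its edge ideal $I(\mathcal{C})$ is the ideal of the polynomial ring $K[x_1,\ldots,x_n]$ over a field $K$ generated by the monomials $\prod_{x_i\in e}x_i$ with $e\in E(\mathcal{C})$. A subset $C\subset V(\mathcal{C})$ is a vertex cover of $\mathcal{C}$ if every edge contains at least one vertex of $C$; it is minimal if no proper subset is a vertex cover. $\alpha_0(\mathcal{C})$ is the minimum number of vertices in a vertex cover ($\alpha_0=0$ if there are no edges). Simis cone: let $C_1,\ldots,C_s$ be the minimal vertex covers of $\mathcal{C}$ and $u_k=\sum_{x_i\in C_k}e_i\in\mathbb{R}^n$ the characteristic vector of $C_k$ for $1\le k\le s$. The Simis cone is $${\rm Cn}(I(\mathcal{C}))=H_{e_1}^+\cap\cdots\cap H_{e_{n+1}}^+\cap H_{(u_1,-1)}^+\cap\cdots\cap H_{(u_s,-1)}^+\subset\mathbb{R}^{n+1},$$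 where $H_c^+=\{x\in\mathbb{R}^{n+1}\mid\langle x,c\rangle\ge0\}$ and $e_1,\ldots,e_{n+1}$ are here the unit vectors of $\mathbb{R}^{n+1}$. Its Hilbert basis is the unique minimal (with respect to inclusion) finite set $\mathcal{H}\subset\mathbb{Z}^{n+1}$ such that ${\rm Cn}(I(\mathcal{C}))=\mathbb{R}_+\mathcal{H}$ and $\mathbb{Z}^{n+1}\cap\mathbb{R}_+\mathcal{H}=\mathbb{N}\mathcal{H}$, where $\mathbb{R}_+\mathcal{H}$ and $\mathbb{N}\mathcal{H}$ are the sets of linear combinations of $\mathcal{H}$ with coefficients in the nonnegative reals and in $\mathbb{N}$, respectively. For $S\subset V(\mathcal{C})$, the induced subclutter $\mathcal{C}[S]$ has vertex set $S$ and as edges exactly the edges of $\mathcal{C}$ contained in $S$. A clutter $\mathcal{C}$ is decomposable if there are nonempty disjoint sets $X_1,X_2$ with $V(\mathcal{C})=X_1\cup X_2$ and $\alpha_0(\mathcal{C})=\alpha_0(\mathcal{C}[X_1])+\alpha_0(\mathcal{C}[X_2])$; otherwise it is indecomposable. By convention, the clutter with empty vertex set is not regarded as indecomposable.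
   Formalization: The formal theorem excludes α=(e_i,0) when {x_i} is an edge of C; there the claim fails: e.g. for n=1 and E(C)={{x_1}}, (1,0) is in the Hilbert basis of the Simis cone but α_0(H)=1≠0. *)

theory Defs
  imports "HOL-Analysis.Analysis"
begin

record 'a hypergraph =
  verts :: "'a set"
  edges :: "'a set set"

definition clutter :: "'a hypergraph \<Rightarrow> bool" where
  "clutter C \<longleftrightarrow> finite (verts C) \<and> verts C \<noteq> {} \<and>
     (\<forall>e\<in>edges C. e \<noteq> {} \<and> e \<subseteq> verts C) \<and>
     (\<forall>e\<in>edges C. \<forall>f\<in>edges C. e \<subseteq> f \<longrightarrow> e = f)"

definition vertex_cover :: "'a hypergraph \<Rightarrow> 'a set \<Rightarrow> bool" where
  "vertex_cover C X \<longleftrightarrow> X \<subseteq> verts C \<and> (\<forall>e\<in>edges C. e \<inter> X \<noteq> {})"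

definition minimal_vertex_cover :: "'a hypergraph \<Rightarrow> 'a set \<Rightarrow> bool" where
  "minimal_vertex_cover C X \<longleftrightarrow> vertex_cover C X \<and> (\<forall>Y. Y \<subset> X \<longrightarrow> \<not> vertex_cover C Y)"

definition cover_number :: "'a hypergraph \<Rightarrow> nat" where
  "cover_number C = Min (card ` {X. vertex_cover C X})"

(* No "clutter" guard here: the induced hypergraph on the empty set has no vertices. *)
definition induced :: "'a hypergraph \<Rightarrow> 'a set \<Rightarrow> 'a hypergraph" where
  "induced C S = \<lparr>verts = S, edges = {e \<in> edges C. e \<subseteq> S}\<rparr>"

definition decomposable :: "'a hypergraph \<Rightarrow> bool" where
  "decomposable C \<longleftrightarrow> (\<exists>X1 X2. X1 \<noteq> {} \<and> X2 \<noteq> {} \<and> X1 \<inter> X2 = {} \<and> verts C = X1 \<union> X2 \<and>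
     cover_number C = cover_number (induced C X1) + cover_number (induced C X2))"

definition indecomposable :: "'a hypergraph \<Rightarrow> bool" where
  "indecomposable C \<longleftrightarrow> verts C \<noteq> {} \<and> \<not> decomposable C"

definition pos_halfspace :: "'v::real_inner \<Rightarrow> 'v set" where
  "pos_halfspace c = {x. x \<bullet> c \<ge> 0}"

definition char_vec :: "'n::finite set \<Rightarrow> real ^ 'n" where
  "char_vec X = (\<Sum>i\<in>X. axis i 1)"

(* The space R^(n+1) is (real ^ 'n) \<times> real, whose standard unit vectors are the elements of Basis.
   The vertex set is meant to be the whole index type 'n.  The cone depends on the edge ideal
   only through the minimal vertex covers of the clutter.
   Pitfall: (axis i 1, 0) is in the Hilbert basis for every i, also when {i} is an edge, although the
   subclutter induced on {i} then has covering number 1; the theorem excludes exactly these vectors. *)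
definition simis_cone :: "'n::finite hypergraph \<Rightarrow> ((real ^ 'n) \<times> real) set" where
  "simis_cone C = (\<Inter>c\<in>Basis. pos_halfspace c) \<inter>
     (\<Inter>X\<in>{X. minimal_vertex_cover C X}. pos_halfspace (char_vec X, -1))"

definition integer_points :: "'v::euclidean_space set" where
  "integer_points = {x. \<forall>u\<in>Basis. x \<bullet> u \<in> \<int>}"

(* The next two are used for finite H only. *)
definition nonneg_real_combs :: "'v::real_vector set \<Rightarrow> 'v set" where
  "nonneg_real_combs H = {\<Sum>h\<in>H. c h *\<^sub>R h | c. \<forall>h\<in>H. (c h :: real) \<ge> 0}"

definition nat_combs :: "'v::real_vector set \<Rightarrow> 'v set" where
  "nat_combs H = {\<Sum>h\<in>H. real (k h) *\<^sub>R h | k :: 'v \<Rightarrow> nat. True}"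

definition integral_generating_set :: "'v::euclidean_space set \<Rightarrow> 'v set \<Rightarrow> bool" where
  "integral_generating_set K H \<longleftrightarrow> finite H \<and> H \<subseteq> integer_points \<and>
     K = nonneg_real_combs H \<and> integer_points \<inter> nonneg_real_combs H = nat_combs H"

definition hilbert_basis :: "'v::euclidean_space set \<Rightarrow> 'v set" where
  "hilbert_basis K = (THE H. integral_generating_set K H \<and>
     (\<forall>H'. H' \<subset> H \<longrightarrow> \<not> integral_generating_set K H'))"

end

(* The cone is pointed and cut out by integral inequalities, so its Hilbert basis is the set of
   irreducible elements of its monoid of lattice points.  This set is finite by Dickson's lemma,
   because the values of the inequalities separate irreducibles into an antichain; it generates the
   real cone because a lattice point in the minimal face of x can be subtracted from x until a
   further inequality becomes tight.

   A vector (char_vec S, b) lies in the cone iff b is at most the covering number t(S) of the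
   subclutter induced on S.  A decomposition of it into lattice points of the cone is a partition
   S = X + Y with b = c + d, c <= t(X), d <= t(Y).  As t is superadditive on disjoint sets, such a
   decomposition of (char_vec S, t(S)) is one of the clutter.  If b < t(S), then a unit vector can
   be split off, since removing a vertex lowers t by at most one. *)
theory Submission
  imports Defs
begin

section \<open>Combinations and integer points\<close>

lemma integer_points_diff: "x \<in> integer_points \<Longrightarrow> y \<in> integer_points \<Longrightarrow> x - y \<in> integer_points"
  by (simp add: integer_points_def inner_diff_left)

lemma integer_points_of_nat_scale: "x \<in> integer_points \<Longrightarrow> real k *\<^sub>R x \<in> integer_points"
  by (simp add: integer_points_def)

lemma integer_points_sum:
  "(\<And>i. i \<in> I \<Longrightarrow> f i \<in> integer_points) \<Longrightarrow> sum f I \<in> integer_points"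
  by (auto simp: integer_points_def inner_sum_left intro!: Ints_sum)

text \<open>Applied to a lattice point and an integral constraint vector, this makes constraint
  values integers, which both the antichain argument and the rounding argument rely on.\<close>

lemma inner_integer_points:
  assumes "x \<in> integer_points" "y \<in> integer_points"
  shows "x \<bullet> y \<in> \<int>"
  using assms by (subst euclidean_inner) (auto simp: integer_points_def intro!: Ints_sum Ints_mult)

lemma nat_combs_zero: "0 \<in> nat_combs H"
  by (auto simp: nat_combs_def intro!: exI[of _ "\<lambda>_. 0"])

lemma nat_combs_generator:
  assumes "finite H" "h \<in> H"
  shows "h \<in> nat_combs H"
proof -
  have "h = (\<Sum>g\<in>H. real (if g = h then 1 else 0) *\<^sub>R g)"
    using assms by (simp add: if_distrib[of real] if_distrib[of "\<lambda>c. c *\<^sub>R _"] cong: if_cong)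
  then show ?thesis
    unfolding nat_combs_def by (intro CollectI exI[of _ "\<lambda>g. if g = h then 1 else 0"]) simp
qed

lemma nat_combs_add:
  assumes "x \<in> nat_combs H" "y \<in> nat_combs H"
  shows "x + y \<in> nat_combs H"
proof -
  obtain k l :: "'a \<Rightarrow> nat"
    where "x = (\<Sum>h\<in>H. real (k h) *\<^sub>R h)" "y = (\<Sum>h\<in>H. real (l h) *\<^sub>R h)"
    using assms unfolding nat_combs_def by blast
  then have "x + y = (\<Sum>h\<in>H. real (k h + l h) *\<^sub>R h)"
    by (simp add: scaleR_left_distrib sum.distrib)
  then show ?thesis
    unfolding nat_combs_def by (intro CollectI exI[of _ "\<lambda>h. k h + l h"]) simp
qed

lemma nat_combs_subset_nonneg_real_combs: "nat_combs H \<subseteq> nonneg_real_combs H"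
proof
  fix x assume "x \<in> nat_combs H"
  then obtain k :: "'a \<Rightarrow> nat" where "x = (\<Sum>h\<in>H. real (k h) *\<^sub>R h)"
    unfolding nat_combs_def by blast
  then show "x \<in> nonneg_real_combs H"
    unfolding nonneg_real_combs_def by (intro CollectI exI[of _ "\<lambda>h. real (k h)"]) simp
qed

lemma nonneg_real_combs_add:
  assumes "x \<in> nonneg_real_combs H" "y \<in> nonneg_real_combs H"
  shows "x + y \<in> nonneg_real_combs H"
proof -
  obtain k l where "x = (\<Sum>h\<in>H. k h *\<^sub>R h)" "y = (\<Sum>h\<in>H. l h *\<^sub>R h)"
    and "\<forall>h\<in>H. 0 \<le> k h" "\<forall>h\<in>H. 0 \<le> l h"
    using assms unfolding nonneg_real_combs_def by blast
  then show ?thesis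
    unfolding nonneg_real_combs_def
    by (intro CollectI exI[of _ "\<lambda>h. k h + l h"]) (simp add: scaleR_left_distrib sum.distrib)
qed

lemma nonneg_real_combs_scale:
  assumes "x \<in> nonneg_real_combs H" "0 \<le> s"
  shows "s *\<^sub>R x \<in> nonneg_real_combs H"
proof -
  obtain k where "x = (\<Sum>h\<in>H. k h *\<^sub>R h)" "\<forall>h\<in>H. 0 \<le> k h"
    using assms unfolding nonneg_real_combs_def by blast
  then show ?thesis
    unfolding nonneg_real_combs_def using assms(2)
    by (intro CollectI exI[of _ "\<lambda>h. s * k h"]) (simp add: scaleR_right.sum)
qed

section \<open>Dickson's lemma\<close>

text \<open>Every sequence has a monotone subsequence. If that one decreases, it attains its least
  value at some index and is constant from there on, so a tail of it is increasing.\<close>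

lemma nat_seq_mono_subseq:
  fixes f :: "nat \<Rightarrow> nat"
  obtains r :: "nat \<Rightarrow> nat" where "strict_mono r" "mono (f \<circ> r)"
proof -
  obtain r where r: "strict_mono r" "monoseq (f \<circ> r)"
    using seq_monosub[of f] by (auto simp: o_def)
  show ?thesis
  proof (cases "mono (f \<circ> r)")
    case True
    then show ?thesis using r that by blast
  next
    case False
    then have dec: "decseq (f \<circ> r)"
      using r(2) unfolding monoseq_iff by simp
    define m where "m = (LEAST v. v \<in> range (f \<circ> r))"
    have "m \<in> range (f \<circ> r)"
      unfolding m_def by (rule LeastI[of _ "(f \<circ> r) 0"]) blast
    then obtain i where i: "m = (f \<circ> r) i" by blast
    have "(f \<circ> r) (i + j) = m" for j
    proof (rule antisym)
      show "(f \<circ> r) (i + j) \<le> m"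
        using dec i by (simp add: decseq_def)
      show "m \<le> (f \<circ> r) (i + j)"
        unfolding m_def by (rule Least_le) blast
    qed
    then have "mono (f \<circ> (\<lambda>j. r (i + j)))"
      by (simp add: mono_def)
    moreover have "strict_mono (\<lambda>j. r (i + j))"
      using r(1) by (simp add: strict_mono_def)
    ultimately show ?thesis using that by blast
  qed
qed

text \<open>The subsequence is refined once for each function; monotonicity already achieved
  survives passing to a further subsequence.\<close>

lemma nat_functions_common_mono_subseq:
  fixes s :: "nat \<Rightarrow> 'a" and f :: "'b \<Rightarrow> 'a \<Rightarrow> nat"
  assumes "finite I"
  shows "\<exists>r :: nat \<Rightarrow> nat. strict_mono r \<and> (\<forall>i\<in>I. mono (f i \<circ> s \<circ> r))"
  using assms
proof (induction I)
  case empty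
  show ?case by (auto intro!: exI[of _ id] strict_mono_id)
next
  case (insert j I)
  then obtain r :: "nat \<Rightarrow> nat" where r: "strict_mono r" "\<forall>i\<in>I. mono (f i \<circ> s \<circ> r)" by blast
  obtain t :: "nat \<Rightarrow> nat" where t: "strict_mono t" "mono (f j \<circ> s \<circ> r \<circ> t)"
    using nat_seq_mono_subseq by blast
  have "mono (f i \<circ> s \<circ> (r \<circ> t))" if "i \<in> I" for i
    using r(2) that t(1) by (auto simp: mono_def strict_mono_less_eq)
  moreover have "strict_mono (r \<circ> t)"
    using r(1) t(1) by (rule strict_mono_o)
  ultimately show ?case
    using t(2) by (intro exI[of _ "r \<circ> t"]) (auto simp only: o_assoc insert_iff)
qed

text \<open>An infinite \<open>S\<close> contains an injective sequence. Along a common monotone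
  subsequence the first two terms are comparable under all \<open>f i\<close>, hence equal, against
  injectivity.\<close>

lemma finite_antichain:
  fixes f :: "'b \<Rightarrow> 'a \<Rightarrow> nat"
  assumes "finite I"
    and antichain: "\<And>x y. x \<in> S \<Longrightarrow> y \<in> S \<Longrightarrow> (\<And>i. i \<in> I \<Longrightarrow> f i x \<le> f i y) \<Longrightarrow> x = y"
  shows "finite S"
proof (rule ccontr)
  assume "infinite S"
  then obtain s :: "nat \<Rightarrow> 'a" where s: "inj s" "range s \<subseteq> S"
    using infinite_countable_subset by blast
  obtain r :: "nat \<Rightarrow> nat" where r: "strict_mono r" "\<forall>i\<in>I. mono (f i \<circ> s \<circ> r)"
    using nat_functions_common_mono_subseq[OF assms(1)] by blast
  have "s (r 0) = s (r 1)"
    using r(2) s(2) by (intro antichain) (auto simp: mono_def)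
  then show False
    using s(1) r(1) by (simp add: inj_eq strict_mono_eq)
qed

section \<open>Hilbert bases of pointed rational cones\<close>

definition irreducibles :: "'a::monoid_add set \<Rightarrow> 'a set" where
  "irreducibles M = {x \<in> M. x \<noteq> 0 \<and> (\<forall>y\<in>M. \<forall>z\<in>M. x = y + z \<longrightarrow> y = 0 \<or> z = 0)}"

text \<open>One generator with a nonzero contribution is split off a natural combination for
  \<open>x\<close>; irreducibility makes the rest vanish, so \<open>x\<close> is that
  generator.\<close>

lemma irreducible_in_integral_generating_set:
  assumes gen: "integral_generating_set K H" and x: "x \<in> irreducibles (K \<inter> integer_points)"
  shows "x \<in> H"
proof -
  have fin: "finite H" and M: "K \<inter> integer_points = nat_combs H"
    using gen unfolding integral_generating_set_def by auto
  obtain k :: "_ \<Rightarrow> nat" where k: "x = (\<Sum>h\<in>H. real (k h) *\<^sub>R h)"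
    using x M unfolding irreducibles_def nat_combs_def by blast
  have "x \<noteq> 0" using x by (simp add: irreducibles_def)
  then obtain g where g: "g \<in> H" "real (k g) *\<^sub>R g \<noteq> 0"
    unfolding k by (metis (no_types, lifting) sum.neutral)
  \<comment> \<open>\<open>k g\<close> is nonzero because its term is, so the truncated subtraction
    removes exactly one copy of \<open>g\<close>.\<close>
  define l where "l = k(g := k g - 1)"
  have "x = g + (\<Sum>h\<in>H. real (l h) *\<^sub>R h)"
    using g(2) unfolding k l_def sum.remove[OF fin g(1)]
    by (cases "k g") (auto simp: algebra_simps intro!: sum.cong)
  moreover have "g \<in> nat_combs H" "(\<Sum>h\<in>H. real (l h) *\<^sub>R h) \<in> nat_combs H"
    using nat_combs_generator[OF fin g(1)] by (auto simp: nat_combs_def)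
  ultimately have "(\<Sum>h\<in>H. real (l h) *\<^sub>R h) = 0"
    using x g(2) unfolding irreducibles_def M by auto
  then show ?thesis
    using \<open>x = g + _\<close> g(1) by simp
qed

text \<open>Having \<open>Basis\<close> among the constraints puts the cone into the nonnegative
  orthant. This makes it pointed and lets the coordinate sum serve as a size.\<close>

locale pointed_rational_cone =
  fixes A :: "'v::euclidean_space set"
  assumes fin: "finite A" and int: "A \<subseteq> integer_points" and Basis: "Basis \<subseteq> A"
begin

definition rational_cone :: "'v set" where
  "rational_cone = (\<Inter>c\<in>A. pos_halfspace c)"

definition lattice_cone :: "'v set" where
  "lattice_cone = rational_cone \<inter> integer_points"

lemma mem_cone: "x \<in> rational_cone \<longleftrightarrow> (\<forall>c\<in>A. 0 \<le> x \<bullet> c)"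
  by (simp add: rational_cone_def pos_halfspace_def)

lemma cone_scale: "x \<in> rational_cone \<Longrightarrow> 0 \<le> s \<Longrightarrow> s *\<^sub>R x \<in> rational_cone"
  by (simp add: mem_cone)

lemma cone_sum: "(\<And>i. i \<in> I \<Longrightarrow> f i \<in> rational_cone) \<Longrightarrow> sum f I \<in> rational_cone"
  by (simp add: mem_cone inner_sum_left sum_nonneg)

lemma cone_nonzero_coordinate:
  assumes "x \<in> rational_cone" "x \<noteq> 0"
  obtains b where "b \<in> Basis" "0 < x \<bullet> b"
proof -
  obtain b where b: "b \<in> Basis" "x \<bullet> b \<noteq> 0"
    using assms(2) euclidean_all_zero_iff[of x] by blast
  then have "0 < x \<bullet> b"
    using assms(1) Basis by (auto simp: mem_cone less_le)
  then show ?thesis using b(1) that by blast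
qed

section \<open>Finiteness of the irreducibles and generation by them\<close>

text \<open>If \<open>x\<close> is below \<open>y\<close> in all constraint values, then
  \<open>y - x\<close> lies in the cone, and irreducibility of \<open>y = x + (y - x)\<close> forces
  \<open>y = x\<close>. So Dickson's lemma applies.\<close>

lemma finite_irreducibles: "finite (irreducibles lattice_cone)"
proof (rule finite_antichain[OF fin])
  fix x y
  assume x: "x \<in> irreducibles lattice_cone" and y: "y \<in> irreducibles lattice_cone"
    and le: "\<And>c. c \<in> A \<Longrightarrow> nat \<lfloor>x \<bullet> c\<rfloor> \<le> nat \<lfloor>y \<bullet> c\<rfloor>"
  have xM: "x \<in> lattice_cone" "x \<noteq> 0" and yM: "y \<in> lattice_cone"
    using x y by (auto simp: irreducibles_def)
  \<comment> \<open>The values are nonnegative integers, so nothing is lost by taking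
    \<open>nat\<close> of the floor.\<close>
  have "x \<bullet> c \<le> y \<bullet> c" if c: "c \<in> A" for c
  proof -
    have "x \<bullet> c \<in> \<int>" "y \<bullet> c \<in> \<int>"
      using xM yM c int by (auto simp: lattice_cone_def intro!: inner_integer_points)
    moreover have "0 \<le> x \<bullet> c" "0 \<le> y \<bullet> c"
      using xM yM c by (auto simp: lattice_cone_def mem_cone)
    ultimately show ?thesis
      using le[OF c] by (auto elim!: Ints_cases)
  qed
  then have "y - x \<in> lattice_cone"
    using xM yM by (auto simp: lattice_cone_def mem_cone inner_diff_left intro!: integer_points_diff)
  moreover have "y = x + (y - x)" by simp
  ultimately show "x = y"
    using y xM unfolding irreducibles_def by fastforce
qed

text \<open>Induction on the coordinate sum. It is a positive integer at every nonzero lattice point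
  of the cone, so both parts of a proper splitting are strictly smaller.\<close>

lemma lattice_cone_subset_nat_combs: "lattice_cone \<subseteq> nat_combs (irreducibles lattice_cone)"
proof
  fix x assume "x \<in> lattice_cone"
  then show "x \<in> nat_combs (irreducibles lattice_cone)"
  proof (induction "nat \<lfloor>\<Sum>b\<in>Basis. x \<bullet> b\<rfloor>" arbitrary: x rule: less_induct)
    case less
    define size where "size y = (\<Sum>b\<in>Basis. y \<bullet> b)" for y :: 'v
    have size_add: "size (y + z) = size y + size z" for y z
      by (simp add: size_def inner_add_left sum.distrib)
    have size_int: "size y \<in> \<int>" if "y \<in> lattice_cone" for y
      using that by (auto simp: size_def lattice_cone_def integer_points_def intro!: Ints_sum)
    have size_pos: "0 < size y" if "y \<in> lattice_cone" "y \<noteq> 0" for y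
    proof -
      have "y \<in> rational_cone" using that by (simp add: lattice_cone_def)
      then obtain b where b: "b \<in> Basis" "0 < y \<bullet> b"
        using \<open>y \<noteq> 0\<close> by (rule cone_nonzero_coordinate)
      show ?thesis
        unfolding size_def by (rule sum_pos2[where i = b])
          (use that b Basis in \<open>auto simp: lattice_cone_def mem_cone\<close>)
    qed
    have smaller: "nat \<lfloor>size y\<rfloor> < nat \<lfloor>size (y + z)\<rfloor>"
      if "y \<in> lattice_cone" "z \<in> lattice_cone" "y \<noteq> 0" "z \<noteq> 0" for y z
      using size_int[of y] size_int[of z] size_pos[of y] size_pos[of z] that
      by (auto simp: size_add elim!: Ints_cases)
    show ?case
    proof (cases "x = 0 \<or> x \<in> irreducibles lattice_cone")
      case True
      then show ?thesis
        using nat_combs_zero nat_combs_generator[OF finite_irreducibles] by auto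
    next
      case False
      then obtain y z where yz: "y \<in> lattice_cone" "z \<in> lattice_cone" "x = y + z" "y \<noteq> 0" "z \<noteq> 0"
        using less.prems unfolding irreducibles_def by blast
      have "y \<in> nat_combs (irreducibles lattice_cone)"
        using less.hyps[of y] smaller[of y z] yz by (simp add: size_def)
      moreover have "z \<in> nat_combs (irreducibles lattice_cone)"
        using less.hyps[of z] smaller[of z y] yz by (simp add: size_def add.commute)
      ultimately show ?thesis
        using yz nat_combs_add by blast
    qed
  qed
qed

text \<open>Approximate a multiple of x simultaneously in the sense of Dirichlet: a constraint
  that is tight at x takes an integer value of modulus less than 1 at the approximating point, so
  it stays tight there.\<close>

lemma lattice_point_in_same_face:
  assumes x: "x \<in> rational_cone" "x \<noteq> 0"
  obtains p where "p \<in> lattice_cone" "p \<noteq> 0" "\<And>c. c \<in> A \<Longrightarrow> x \<bullet> c = 0 \<Longrightarrow> p \<bullet> c = 0"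
proof -
  define P where "P = (\<lambda>c. x \<bullet> c) ` {c \<in> A. x \<bullet> c \<noteq> 0}"
  have "finite P" using fin by (simp add: P_def)
  \<comment> \<open>A positive lower bound for the values of the constraints not tight at
    \<open>x\<close>: dividing \<open>x\<close> by it makes them all at least 1. Inserting 1 keeps
    the set visibly nonempty.\<close>
  define d where "d = Min (insert 1 P)"
  have d: "0 < d"
    using \<open>finite P\<close> x(1) unfolding d_def by (subst Min_gr_iff) (auto simp: P_def mem_cone less_le)
  have d_le: "d \<le> x \<bullet> c" if "c \<in> A" "x \<bullet> c \<noteq> 0" for c
    using that \<open>finite P\<close> unfolding d_def by (intro Min_le) (auto simp: P_def)
  \<comment> \<open>The 1-norm of \<open>c\<close>: coordinate errors below \<open>1 / N\<close>
    change the value at \<open>c\<close> by at most \<open>w c / N\<close>. Hence \<open>N\<close>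
    is chosen larger than all these norms.\<close>
  define w where "w c = (\<Sum>b\<in>Basis. \<bar>c \<bullet> b\<bar>)" for c :: 'v
  have w0: "0 \<le> w c" for c by (simp add: w_def sum_nonneg)
  obtain N :: nat where N: "(\<Sum>c\<in>A. w c) < real N"
    using reals_Archimedean2 by blast
  have wN: "w c < real N" if "c \<in> A" for c
    using member_le_sum[of c A w] that w0 fin N by fastforce
  have "0 < N"
    using N sum_nonneg[of A w] w0 by (metis le_less_trans of_nat_0_less_iff)
  obtain e :: "nat \<Rightarrow> 'v" where e: "bij_betw e {0..<DIM('v)} Basis"
    using ex_bij_betw_nat_finite[OF finite_Basis] by blast
  obtain q :: int and z where q: "0 < q"
    and z: "\<And>i. i < DIM('v) \<Longrightarrow> \<bar>of_int q * (x \<bullet> e i / d) - of_int (z i)\<bar> < 1 / N"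
    using Dirichlet_approx_simult[OF \<open>0 < N\<close>, of "DIM('v)" "\<lambda>i. x \<bullet> e i / d"] by metis
  define p where "p = (\<Sum>i<DIM('v). real_of_int (z i) *\<^sub>R e i)"
  have e_basis: "e i \<in> Basis" if "i < DIM('v)" for i
    using e that by (auto simp: bij_betw_def)
  have basis_int: "Basis \<subseteq> (integer_points :: 'v set)"
    using int Basis by blast
  have p_int: "p \<in> integer_points"
    unfolding p_def
  proof (rule integer_points_sum)
    fix i assume "i \<in> {..<DIM('v)}"
    then have "e i \<in> integer_points" using e_basis basis_int by auto
    then show "real_of_int (z i) *\<^sub>R e i \<in> integer_points"
      by (simp add: integer_points_def)
  qed
  have reindex: "(\<Sum>b\<in>Basis. f b) = (\<Sum>i<DIM('v). f (e i))" for f :: "'v \<Rightarrow> real"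
    using sum.reindex_bij_betw[OF e, of f] by (simp add: atLeast0LessThan)
  have close: "\<bar>of_int q * (x \<bullet> c / d) - p \<bullet> c\<bar> < 1" if c: "c \<in> A" for c
  proof -
    have "of_int q * (x \<bullet> c / d) - p \<bullet> c
        = (\<Sum>i<DIM('v). (of_int q * (x \<bullet> e i / d) - of_int (z i)) * (c \<bullet> e i))"
      by (subst euclidean_inner)
        (simp add: reindex p_def inner_sum_left sum_distrib_left sum_divide_distrib
          inner_sum_right left_diff_distrib sum_subtractf inner_commute[of _ c] mult.assoc)
    also have "\<bar>\<dots>\<bar> \<le> (\<Sum>i<DIM('v). 1 / N * \<bar>c \<bullet> e i\<bar>)"
    proof (rule order_trans[OF sum_abs], rule sum_mono)
      fix i assume "i \<in> {..<DIM('v)}"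
      then show "\<bar>(of_int q * (x \<bullet> e i / d) - of_int (z i)) * (c \<bullet> e i)\<bar> \<le> 1 / N * \<bar>c \<bullet> e i\<bar>"
        unfolding abs_mult by (intro mult_right_mono less_imp_le[OF z]) auto
    qed
    also have "\<dots> = w c / N"
      by (simp add: w_def reindex sum_divide_distrib)
    also have "\<dots> < 1"
      using wN[OF c] \<open>0 < N\<close> by simp
    finally show ?thesis .
  qed
  have tight: "p \<bullet> c = 0" if "c \<in> A" "x \<bullet> c = 0" for c
  proof -
    have "p \<bullet> c \<in> \<int>" using that int p_int inner_integer_points by blast
    then show ?thesis
      using close[of c] that by (auto elim!: Ints_cases)
  qed
  \<comment> \<open>At \<open>q / d\<close> times \<open>x\<close> such a constraint has value at
    least 1, and the error is below 1.\<close>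
  have loose: "0 < p \<bullet> c" if "c \<in> A" "x \<bullet> c \<noteq> 0" for c
  proof -
    have "1 \<le> x \<bullet> c / d" using d_le[OF that] d by simp
    moreover have "1 \<le> real_of_int q" using q by simp
    ultimately have "1 \<le> of_int q * (x \<bullet> c / d)"
      by (metis mult_mono mult_1 zero_le_one order_trans)
    then show ?thesis using close[OF that(1)] by linarith
  qed
  obtain b where "b \<in> Basis" "0 < x \<bullet> b"
    using cone_nonzero_coordinate[OF x] by blast
  then have "p \<noteq> 0"
    using loose[of b] Basis by auto
  moreover have "p \<in> lattice_cone"
    using p_int tight loose by (force simp: lattice_cone_def mem_cone less_le)
  ultimately show ?thesis using tight that by blast
qed

text \<open>Induction on the number of constraints not tight at \<open>x\<close>. From
  \<open>x\<close> one subtracts the largest multiple of a lattice point \<open>p\<close> of its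
  minimal face that stays in the cone.\<close>

lemma cone_subset_nonneg_real_combs: "rational_cone \<subseteq> nonneg_real_combs (irreducibles lattice_cone)"
proof
  fix x assume "x \<in> rational_cone"
  then show "x \<in> nonneg_real_combs (irreducibles lattice_cone)"
  proof (induction "card {c \<in> A. x \<bullet> c \<noteq> 0}" arbitrary: x rule: less_induct)
    case less
    show ?case
    proof (cases "x = 0")
      case True
      then show ?thesis
        using nat_combs_zero nat_combs_subset_nonneg_real_combs by blast
    next
      case False
      then obtain p where p: "p \<in> lattice_cone" "p \<noteq> 0"
        and tight: "\<And>c. c \<in> A \<Longrightarrow> x \<bullet> c = 0 \<Longrightarrow> p \<bullet> c = 0"
        using lattice_point_in_same_face less.prems by blast
      have p_cone: "p \<in> rational_cone" using p by (simp add: lattice_cone_def)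
      define R where "R = (\<lambda>c. x \<bullet> c / (p \<bullet> c)) ` {c \<in> A. p \<bullet> c \<noteq> 0}"
      obtain b where "b \<in> Basis" "0 < p \<bullet> b"
        using cone_nonzero_coordinate p_cone p(2) by blast
      then have "R \<noteq> {}" using Basis by (force simp: R_def)
      have "finite R" using fin by (simp add: R_def)
      \<comment> \<open>A ratio test: \<open>s\<close> is the largest multiplier that keeps all
        constraints nonnegative, and the constraint attaining the minimum becomes tight.\<close>
      define s where "s = Min R"
      have "s \<in> R"
        using \<open>finite R\<close> \<open>R \<noteq> {}\<close> by (simp add: s_def)
      then obtain c0 where c0: "c0 \<in> A" "p \<bullet> c0 \<noteq> 0" "s = x \<bullet> c0 / (p \<bullet> c0)"
        by (auto simp: R_def)
      have s0: "0 \<le> s"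
        using c0 less.prems p_cone by (simp add: mem_cone)
      define y where "y = x - s *\<^sub>R p"
      have "0 \<le> y \<bullet> c" if c: "c \<in> A" for c
      proof (cases "p \<bullet> c = 0")
        case True
        then show ?thesis
          using c less.prems by (simp add: y_def inner_diff_left mem_cone)
      next
        case False
        then have "s \<le> x \<bullet> c / (p \<bullet> c)"
          using \<open>finite R\<close> c unfolding s_def by (intro Min_le) (auto simp: R_def)
        moreover have "0 < p \<bullet> c"
          using False p_cone c by (simp add: mem_cone less_le)
        ultimately show ?thesis
          by (simp add: y_def inner_diff_left field_simps)
      qed
      then have y: "y \<in> rational_cone" by (simp add: mem_cone)
      have "y \<bullet> c0 = 0"
        using c0 by (simp add: y_def inner_diff_left)
      moreover have "y \<bullet> c = 0" if "c \<in> A" "x \<bullet> c = 0" for c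
        using that tight by (simp add: y_def inner_diff_left)
      \<comment> \<open>The constraint \<open>c0\<close> was not tight at \<open>x\<close>, since
        otherwise \<open>p\<close> would vanish on it; hence the inclusion is strict.\<close>
      ultimately have "{c \<in> A. y \<bullet> c \<noteq> 0} \<subset> {c \<in> A. x \<bullet> c \<noteq> 0}"
        using c0 tight by blast
      then have "y \<in> nonneg_real_combs (irreducibles lattice_cone)"
        using fin y by (intro less.hyps psubset_card_mono) auto
      moreover have "s *\<^sub>R p \<in> nonneg_real_combs (irreducibles lattice_cone)"
        using p(1) s0 lattice_cone_subset_nat_combs nat_combs_subset_nonneg_real_combs
        by (intro nonneg_real_combs_scale) auto
      moreover have "x = y + s *\<^sub>R p" by (simp add: y_def)
      ultimately show ?thesis
        using nonneg_real_combs_add by metis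
    qed
  qed
qed

section \<open>Existence and uniqueness of the Hilbert basis\<close>

lemma integral_generating_set_irreducibles:
  "integral_generating_set rational_cone (irreducibles lattice_cone)"
proof -
  let ?H = "irreducibles lattice_cone"
  have H: "?H \<subseteq> rational_cone" "?H \<subseteq> integer_points"
    by (auto simp: irreducibles_def lattice_cone_def)
  have "nonneg_real_combs ?H \<subseteq> rational_cone"
    using H(1) unfolding nonneg_real_combs_def by (auto intro!: cone_sum cone_scale)
  then have cone_eq: "rational_cone = nonneg_real_combs ?H"
    using cone_subset_nonneg_real_combs by blast
  have "nat_combs ?H \<subseteq> integer_points"
    using H(2) unfolding nat_combs_def
    by (auto intro!: integer_points_sum integer_points_of_nat_scale)
  then have "integer_points \<inter> rational_cone = nat_combs ?H"
    using lattice_cone_subset_nat_combs nat_combs_subset_nonneg_real_combs cone_eq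
    unfolding lattice_cone_def by blast
  then show ?thesis
    unfolding integral_generating_set_def using finite_irreducibles H(2) cone_eq by metis
qed

text \<open>The irreducibles form a generating set contained in every other one, so they are the
  only minimal one and the definite description is well defined.\<close>

theorem hilbert_basis_cone: "hilbert_basis rational_cone = irreducibles lattice_cone"
proof -
  have least: "irreducibles lattice_cone \<subseteq> H" if "integral_generating_set rational_cone H" for H
    using irreducible_in_integral_generating_set[OF that] by (auto simp: lattice_cone_def)
  show ?thesis
    unfolding hilbert_basis_def
  proof (rule the_equality)
    show "integral_generating_set rational_cone (irreducibles lattice_cone) \<and>
        (\<forall>H'. H' \<subset> irreducibles lattice_cone \<longrightarrow> \<not> integral_generating_set rational_cone H')"
      using integral_generating_set_irreducibles least by blast
  next
    fix H
    assume "integral_generating_set rational_cone H \<and> (\<forall>H'. H' \<subset> H \<longrightarrow> \<not> integral_generating_set rational_cone H')"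
    then show "H = irreducibles lattice_cone"
      using least[of H] integral_generating_set_irreducibles by blast
  qed
qed

end

section \<open>Lattice points of the Simis cone\<close>

lemma vertex_cover_contains_minimal:
  assumes "vertex_cover C X" "finite X"
  obtains Y where "minimal_vertex_cover C Y" "Y \<subseteq> X"
proof -
  have "{Y \<in> Pow X. vertex_cover C Y} \<noteq> {}" "finite {Y \<in> Pow X. vertex_cover C Y}"
    using assms by auto
  then obtain Y where Y: "Y \<in> {Y \<in> Pow X. vertex_cover C Y}"
    and least: "\<forall>Z\<in>{Y \<in> Pow X. vertex_cover C Y}. Z \<subseteq> Y \<longrightarrow> Y = Z"
    using finite_has_minimal[of "{Y \<in> Pow X. vertex_cover C Y}"] by metis
  have "minimal_vertex_cover C Y"
    unfolding minimal_vertex_cover_def using Y least by blast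
  then show ?thesis using Y that by blast
qed

lemma vertex_cover_verts: "clutter C \<Longrightarrow> vertex_cover C (verts C)"
  unfolding clutter_def vertex_cover_def by blast

section \<open>Characteristic vectors and membership in the Simis cone\<close>

lemma char_vec_nth: "char_vec X $ i = (if i \<in> X then 1 else 0)"
  by (simp add: char_vec_def axis_def sum_component)

lemma char_vec_Un: "X \<inter> Y = {} \<Longrightarrow> char_vec (X \<union> Y) = char_vec X + char_vec Y"
  by (simp add: char_vec_def sum.union_disjoint)

lemma char_vec_eq_0_iff: "char_vec X = 0 \<longleftrightarrow> X = {}"
  by (auto simp: vec_eq_iff char_vec_nth split: if_splits)

lemma inner_char_vec: "x \<bullet> char_vec X = (\<Sum>i\<in>X. x $ i)"
  by (simp add: char_vec_def inner_sum_right inner_axis)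

lemma sum_char_vec: "(\<Sum>i\<in>X. char_vec S $ i) = card (X \<inter> S)"
  by (simp add: char_vec_nth sum.If_cases)

lemma mem_integer_points_vec_real:
  fixes x :: "real ^ 'n" and t :: real
  shows "(x, t) \<in> integer_points \<longleftrightarrow> (\<forall>i. x $ i \<in> \<int>) \<and> t \<in> \<int>"
  by (auto simp: integer_points_def Basis_prod_def Basis_vec_def inner_axis ball_Un)

text \<open>Every cover contains a minimal one, and with nonnegative coordinates the larger sum is
  no smaller. So the inequalities may range over all covers, and minimality disappears from the
  later arguments.\<close>

lemma mem_simis_cone:
  fixes C :: "'n::finite hypergraph"
  shows "(x, t) \<in> simis_cone C \<longleftrightarrow>
    (\<forall>i. 0 \<le> x $ i) \<and> 0 \<le> t \<and> (\<forall>X. vertex_cover C X \<longrightarrow> t \<le> (\<Sum>i\<in>X. x $ i))"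
proof -
  have "(x, t) \<in> simis_cone C \<longleftrightarrow> (\<forall>i. 0 \<le> x $ i) \<and> 0 \<le> t \<and>
      (\<forall>X. minimal_vertex_cover C X \<longrightarrow> t \<le> (\<Sum>i\<in>X. x $ i))"
    by (auto simp: simis_cone_def pos_halfspace_def Basis_prod_def Basis_vec_def inner_axis inner_char_vec)
  also have "\<dots> \<longleftrightarrow> (\<forall>i. 0 \<le> x $ i) \<and> 0 \<le> t \<and>
      (\<forall>X. vertex_cover C X \<longrightarrow> t \<le> (\<Sum>i\<in>X. x $ i))"
  proof (intro conj_cong refl iffI allI impI)
    fix X
    assume x: "\<forall>i. 0 \<le> x $ i" and X: "vertex_cover C X"
      and min: "\<forall>X. minimal_vertex_cover C X \<longrightarrow> t \<le> (\<Sum>i\<in>X. x $ i)"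
    obtain Y where Y: "minimal_vertex_cover C Y" "Y \<subseteq> X"
      using vertex_cover_contains_minimal[OF X finite] .
    then have "t \<le> (\<Sum>i\<in>Y. x $ i)" using min by blast
    also have "\<dots> \<le> (\<Sum>i\<in>X. x $ i)"
      using Y(2) x by (intro sum_mono2) auto
    finally show "t \<le> (\<Sum>i\<in>X. x $ i)" .
  qed (auto simp: minimal_vertex_cover_def)
  finally show ?thesis .
qed

text \<open>The unit vectors and the vectors \<open>(char_vec X, -1)\<close> form a finite integral
  constraint set, so the general result applies.\<close>

lemma hilbert_basis_simis_cone:
  fixes C :: "'n::finite hypergraph"
  shows "hilbert_basis (simis_cone C) = irreducibles (simis_cone C \<inter> integer_points)"
proof -
  define A where "A = Basis \<union> (\<lambda>X. (char_vec X, -1 :: real)) ` {X. minimal_vertex_cover C X}"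
  interpret pointed_rational_cone A
  proof
    show "finite A" by (simp add: A_def)
    have "(x :: (real ^ 'n) \<times> real) \<in> integer_points" if "x \<in> Basis" for x
      using that by (auto simp: integer_points_def inner_Basis)
    then show "A \<subseteq> integer_points"
      by (auto simp: A_def mem_integer_points_vec_real char_vec_nth)
  qed (simp add: A_def)
  have "simis_cone C = rational_cone"
    unfolding rational_cone_def by (auto simp: simis_cone_def A_def)
  then show ?thesis
    using hilbert_basis_cone by (simp add: lattice_cone_def)
qed

section \<open>Covering numbers of induced subclutters\<close>

text \<open>The covers of the induced subclutter are exactly the traces on \<open>S\<close> of
  covers of \<open>C\<close>, so its covering number is the minimum of
  \<open>card (X \<inter> S)\<close>.\<close>

lemma le_cover_number_induced_iff:
  fixes C :: "'n::finite hypergraph"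
  assumes "clutter C" "verts C = UNIV"
  shows "b \<le> cover_number (induced C S) \<longleftrightarrow> (\<forall>X. vertex_cover C X \<longrightarrow> b \<le> card (X \<inter> S))"
proof -
  have "vertex_cover (induced C S) S"
    using assms(1) by (simp add: vertex_cover_def induced_def clutter_def Int_absorb2)
  then have "b \<le> cover_number (induced C S) \<longleftrightarrow>
      (\<forall>Y. vertex_cover (induced C S) Y \<longrightarrow> b \<le> card Y)"
    unfolding cover_number_def by (subst Min_ge_iff) auto
  also have "\<dots> \<longleftrightarrow> (\<forall>X. vertex_cover C X \<longrightarrow> b \<le> card (X \<inter> S))"
  proof (intro iffI allI impI)
    fix X
    assume "\<forall>Y. vertex_cover (induced C S) Y \<longrightarrow> b \<le> card Y" "vertex_cover C X"
    moreover from this(2) have "vertex_cover (induced C S) (X \<inter> S)"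
      unfolding vertex_cover_def induced_def by auto
    ultimately show "b \<le> card (X \<inter> S)" by blast
  next
    fix Y
    assume le: "\<forall>X. vertex_cover C X \<longrightarrow> b \<le> card (X \<inter> S)" and Y: "vertex_cover (induced C S) Y"
    \<comment> \<open>Edges inside \<open>S\<close> meet \<open>Y\<close>, and all other edges meet
      the complement of \<open>S\<close>.\<close>
    have "vertex_cover C (Y \<union> - S)"
      using Y assms(2) unfolding vertex_cover_def induced_def by auto
    then have "b \<le> card ((Y \<union> - S) \<inter> S)" using le by blast
    also have "(Y \<union> - S) \<inter> S = Y"
      using Y by (auto simp: vertex_cover_def induced_def)
    finally show "b \<le> card Y" .
  qed
  finally show ?thesis .
qed

text \<open>A cover of \<open>C\<close> meets \<open>S\<close> and \<open>T\<close> in disjoint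
  sets, each at least as large as the respective covering number.\<close>

lemma cover_number_induced_superadditive:
  fixes C :: "'n::finite hypergraph"
  assumes C: "clutter C" "verts C = UNIV" and "S \<inter> T = {}"
  shows "cover_number (induced C S) + cover_number (induced C T) \<le> cover_number (induced C (S \<union> T))"
proof -
  have "cover_number (induced C S) + cover_number (induced C T) \<le> card (X \<inter> (S \<union> T))"
    if "vertex_cover C X" for X
  proof -
    have "card (X \<inter> (S \<union> T)) = card (X \<inter> S) + card (X \<inter> T)"
      using assms(3) by (subst card_Un_disjoint[symmetric]) (auto simp: Int_Un_distrib)
    moreover have "cover_number (induced C S) \<le> card (X \<inter> S)" "cover_number (induced C T) \<le> card (X \<inter> T)"
      using that le_cover_number_induced_iff[OF C] by blast+
    ultimately show ?thesis by simp
  qed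
  then show ?thesis using le_cover_number_induced_iff[OF C] by blast
qed

lemma cover_number_induced_empty:
  fixes C :: "'n::finite hypergraph"
  assumes C: "clutter C" "verts C = UNIV"
  shows "cover_number (induced C {}) = 0"
  using le_cover_number_induced_iff[OF C, of "cover_number (induced C {})" "{}"]
    vertex_cover_verts[OF C(1)] by auto

text \<open>For every cover \<open>X\<close>, dropping \<open>i\<close> from \<open>S\<close> lowers
  \<open>card (X \<inter> S)\<close> by at most one.\<close>

lemma le_cover_number_induced_remove:
  fixes C :: "'n::finite hypergraph"
  assumes C: "clutter C" "verts C = UNIV" and "b < cover_number (induced C S)"
  shows "b \<le> cover_number (induced C (S - {i}))"
proof -
  have "b \<le> card (X \<inter> (S - {i}))" if "vertex_cover C X" for X
  proof -
    have "Suc b \<le> card (X \<inter> S)"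
      using assms(3) that le_cover_number_induced_iff[OF C, of "Suc b" S] by simp
    also have "\<dots> \<le> card (insert i (X \<inter> (S - {i})))"
      by (intro card_mono) auto
    also have "\<dots> \<le> Suc (card (X \<inter> (S - {i})))"
      by (rule card_insert_le_m1) auto
    finally show ?thesis by simp
  qed
  then show ?thesis using le_cover_number_induced_iff[OF C] by blast
qed

text \<open>The complement of \<open>i\<close> has empty trace on \<open>{i}\<close>, so it cannot
  be a cover. The edge that it misses is nonempty and inside \<open>{i}\<close>.\<close>

lemma singleton_edge_if_cover_number_pos:
  fixes C :: "'n::finite hypergraph"
  assumes C: "clutter C" "verts C = UNIV" and "0 < cover_number (induced C {i})"
  shows "{i} \<in> edges C"
proof -
  have "\<not> vertex_cover C (- {i})"
    using assms(3) le_cover_number_induced_iff[OF C, of 1 "{i}"] by force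
  then obtain e where "e \<in> edges C" "e \<subseteq> {i}"
    using C(2) by (auto simp: vertex_cover_def)
  then show ?thesis
    using C(1) by (auto simp: clutter_def subset_singleton_iff)
qed

section \<open>Splittings of characteristic vectors and decompositions\<close>

text \<open>Summing \<open>char_vec S\<close> over a cover \<open>X\<close> gives
  \<open>card (X \<inter> S)\<close>, so the cover inequalities say that \<open>b\<close> is at most
  each of these numbers.\<close>

lemma char_vec_mem_simis_lattice:
  fixes C :: "'n::finite hypergraph"
  assumes C: "clutter C" "verts C = UNIV"
  shows "(char_vec S, real b) \<in> simis_cone C \<inter> integer_points \<longleftrightarrow> b \<le> cover_number (induced C S)"
  by (simp add: mem_simis_cone mem_integer_points_vec_real char_vec_nth[of S] sum_char_vec[unfolded char_vec_nth]
      le_cover_number_induced_iff[OF C])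

text \<open>In each coordinate two nonnegative integers add up to 0 or 1, so both are 0 or 1 and at
  most one of them is 1.\<close>

lemma char_vec_split_nonneg_integral:
  fixes y z :: "real ^ 'n"
  assumes sum: "char_vec S = y + z"
    and y: "\<And>i. 0 \<le> y $ i" "\<And>i. y $ i \<in> \<int>" and z: "\<And>i. 0 \<le> z $ i" "\<And>i. z $ i \<in> \<int>"
  obtains Y Z where "y = char_vec Y" "z = char_vec Z" "Y \<inter> Z = {}" "S = Y \<union> Z"
proof -
  have cases: "y $ i = 0 \<and> z $ i = 0 \<and> i \<notin> S \<or> y $ i = 1 \<and> z $ i = 0 \<and> i \<in> S \<or>
      y $ i = 0 \<and> z $ i = 1 \<and> i \<in> S" for i
  proof -
    obtain m n where mn: "y $ i = of_int m" "z $ i = of_int n"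
      using y(2)[of i] z(2)[of i] by (auto elim!: Ints_cases)
    have "0 \<le> m" "0 \<le> n" using mn y(1)[of i] z(1)[of i] by auto
    moreover have "m + n = (if i \<in> S then 1 else 0)"
    proof -
      have "real_of_int (m + n) = char_vec S $ i"
        by (simp add: sum mn)
      then show ?thesis by (auto simp: char_vec_nth split: if_splits)
    qed
    ultimately have "m = 0 \<and> n = 0 \<and> i \<notin> S \<or> m = 1 \<and> n = 0 \<and> i \<in> S \<or> m = 0 \<and> n = 1 \<and> i \<in> S"
      by (auto split: if_splits)
    then show ?thesis using mn by auto
  qed
  have disjoint: "\<not> (y $ i = 1 \<and> z $ i = 1)" and union: "i \<in> S \<longleftrightarrow> y $ i = 1 \<or> z $ i = 1" for i
    using cases[of i] by auto
  show ?thesis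
  proof (rule that)
    show "y = char_vec {i. y $ i = 1}" "z = char_vec {i. z $ i = 1}"
      using cases by (force simp: vec_eq_iff char_vec_nth)+
    show "{i. y $ i = 1} \<inter> {i. z $ i = 1} = {}"
      using disjoint by blast
    show "S = {i. y $ i = 1} \<union> {i. z $ i = 1}"
      using union by blast
  qed
qed

lemma induced_induced: "T \<subseteq> S \<Longrightarrow> induced (induced C S) T = induced C T"
  by (auto simp: induced_def)

lemma decomposable_induced_iff:
  "decomposable (induced C S) \<longleftrightarrow> (\<exists>X Y. X \<noteq> {} \<and> Y \<noteq> {} \<and> X \<inter> Y = {} \<and> S = X \<union> Y \<and>
     cover_number (induced C S) = cover_number (induced C X) + cover_number (induced C Y))"
proof -
  have "induced (induced C S) X = induced C X" "induced (induced C S) Y = induced C Y"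
    if "S = X \<union> Y" for X Y
    using that by (simp_all add: induced_induced)
  moreover have "verts (induced C S) = S" by (simp add: induced_def)
  ultimately show ?thesis
    unfolding decomposable_def by (intro ex_cong1 conj_cong refl) auto
qed

text \<open>Splittings of the vector in the monoid correspond to partitions of \<open>S\<close>
  together with a splitting of \<open>b\<close> bounded by the covering numbers.
  \<open>not_unit\<close> rules out the one case where a unit vector cannot be split off properly
  although \<open>b\<close> is too small.\<close>

lemma char_vec_irreducible_iff:
  fixes C :: "'n::finite hypergraph"
  assumes C: "clutter C" "verts C = UNIV"
    and not_unit: "\<And>i. {i} \<in> edges C \<Longrightarrow> (S, b) \<noteq> ({i}, 0)"
  shows "(char_vec S, real b) \<in> irreducibles (simis_cone C \<inter> integer_points) \<longleftrightarrow>
    indecomposable (induced C S) \<and> b = cover_number (induced C S)"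
    (is "?v \<in> irreducibles ?M \<longleftrightarrow> _")
proof
  let ?\<tau> = "\<lambda>S. cover_number (induced C S)"
  note mem = char_vec_mem_simis_lattice[OF C]
  assume "?v \<in> irreducibles ?M"
  then have v: "?v \<in> ?M" "?v \<noteq> 0" and
    irr: "\<And>y z. y \<in> ?M \<Longrightarrow> z \<in> ?M \<Longrightarrow> ?v = y + z \<Longrightarrow> y = 0 \<or> z = 0"
    by (auto simp: irreducibles_def)
  have no_split: "X = {} \<and> c = 0 \<or> Y = {} \<and> d = 0"
    if "S = X \<union> Y" "X \<inter> Y = {}" "b = c + d" "c \<le> ?\<tau> X" "d \<le> ?\<tau> Y" for X Y c d
    using irr[of "(char_vec X, real c)" "(char_vec Y, real d)"] that
    unfolding mem by (simp add: char_vec_Un zero_prod_def char_vec_eq_0_iff)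
  have b_le: "b \<le> ?\<tau> S" using v(1) unfolding mem .
  \<comment> \<open>For empty \<open>S\<close> the bound gives \<open>b = 0\<close>, and the vector
    would be 0.\<close>
  have "S \<noteq> {}"
    using v(2) b_le cover_number_induced_empty[OF C] by (auto simp: zero_prod_def char_vec_eq_0_iff)
  have b: "b = ?\<tau> S"
  proof (rule ccontr)
    assume "b \<noteq> ?\<tau> S"
    with b_le have less: "b < ?\<tau> S" by simp
    obtain i where i: "i \<in> S" using \<open>S \<noteq> {}\<close> by blast
    \<comment> \<open>The unit vector at \<open>i\<close>, with last entry 0, is split off. The
      remainder stays in the cone because \<open>b\<close> is below the covering number;
      irreducibility then makes it 0.\<close>
    have "S - {i} = {} \<and> b = 0"
      using no_split[of "S - {i}" "{i}" b 0] i le_cover_number_induced_remove[OF C less] by auto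
    then have "S = {i}" "b = 0" using i by auto
    then show False
      using less singleton_edge_if_cover_number_pos[OF C] not_unit by blast
  qed
  \<comment> \<open>A decomposition into \<open>X\<close> and \<open>Y\<close> would give a
    splitting with \<open>c = ?\<tau> X\<close> and \<open>d = ?\<tau> Y\<close>.\<close>
  moreover have "\<not> decomposable (induced C S)"
    using no_split b unfolding decomposable_induced_iff by blast
  ultimately show "indecomposable (induced C S) \<and> b = ?\<tau> S"
    using \<open>S \<noteq> {}\<close> by (simp add: indecomposable_def induced_def)
next
  let ?\<tau> = "\<lambda>S. cover_number (induced C S)"
  note mem = char_vec_mem_simis_lattice[OF C]
  assume "indecomposable (induced C S) \<and> b = ?\<tau> S"
  then have S: "S \<noteq> {}" "\<not> decomposable (induced C S)" and b: "b = ?\<tau> S"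
    by (auto simp: indecomposable_def induced_def)
  have "y = 0 \<or> z = 0" if y: "y \<in> ?M" and z: "z \<in> ?M" and yz: "?v = y + z" for y z
  proof -
    have nat_snd: "\<exists>n. snd w = real n" if "w \<in> ?M" for w
      using that by (cases w) (auto simp: mem_simis_cone mem_integer_points_vec_real elim!: Ints_cases
          intro!: exI[of _ "nat \<lfloor>snd w\<rfloor>"])
    have fst: "0 \<le> fst w $ i" "fst w $ i \<in> \<int>" if "w \<in> ?M" for w i
      using that by (cases w; simp add: mem_simis_cone mem_integer_points_vec_real)+
    have "char_vec S = fst y + fst z" using yz by (cases y, cases z) simp
    then obtain Y Z where YZ: "fst y = char_vec Y" "fst z = char_vec Z" "Y \<inter> Z = {}" "S = Y \<union> Z"
      using char_vec_split_nonneg_integral fst[OF y] fst[OF z] by metis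
    obtain c d where cd: "snd y = real c" "snd z = real d"
      using nat_snd y z by metis
    have y_eq: "y = (char_vec Y, real c)" and z_eq: "z = (char_vec Z, real d)"
      using YZ cd by (simp_all add: prod_eq_iff)
    have le: "c \<le> ?\<tau> Y" "d \<le> ?\<tau> Z"
      using y z unfolding y_eq z_eq mem by auto
    have "real b = real (c + d)" using yz by (simp add: y_eq z_eq)
    then have "b = c + d" by linarith
    \<comment> \<open>\<open>c + d\<close> equals \<open>?\<tau> S\<close>, is at most the sum of
      the two covering numbers, and that sum is at most \<open>?\<tau> S\<close> by superadditivity;
      so equality holds throughout.\<close>
    then have "?\<tau> S = ?\<tau> Y + ?\<tau> Z"
      using le b cover_number_induced_superadditive[OF C YZ(3)] YZ(4) by simp
    then have "Y = {} \<or> Z = {}"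
      using S(2) YZ(3,4) unfolding decomposable_induced_iff by blast
    \<comment> \<open>An empty part has covering number 0, which forces its last entry and hence the
      whole summand to be 0.\<close>
    then show ?thesis
      using le cover_number_induced_empty[OF C]
      by (auto simp: y_eq z_eq zero_prod_def char_vec_eq_0_iff)
  qed
  moreover have "?v \<in> ?M" using b mem by simp
  moreover have "?v \<noteq> 0" using S(1) by (simp add: zero_prod_def char_vec_eq_0_iff)
  ultimately show "?v \<in> irreducibles ?M"
    by (auto simp: irreducibles_def)
qed

theorem corollary3p3:
  fixes C :: "'n::finite hypergraph" and a :: "real ^ 'n" and b :: nat
  assumes "clutter C" and "verts C = UNIV"
    and "\<forall>i. a $ i \<in> {0, 1}"
    and "\<forall>i. {i} \<in> edges C \<longrightarrow> (a, b) \<noteq> (axis i 1, 0)"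
  shows "(a, real b) \<in> hilbert_basis (simis_cone C) \<longleftrightarrow>
    indecomposable (induced C {i. a $ i = 1}) \<and> b = cover_number (induced C {i. a $ i = 1})"
proof -
  have a: "a = char_vec {i. a $ i = 1}"
    using assms(3) by (force simp: vec_eq_iff char_vec_nth)
  \<comment> \<open>The exclusion of certain unit vectors is carried over from \<open>a\<close> to
    its support.\<close>
  have "({i. a $ i = 1}, b) \<noteq> ({i}, 0)" if "{i} \<in> edges C" for i
  proof
    assume "({i. a $ i = 1}, b) = ({i}, 0)"
    then have "a = axis i 1" "b = 0"
      using a by (auto simp: char_vec_def)
    then show False using assms(4) that by blast
  qed
  then have "(char_vec {i. a $ i = 1}, real b) \<in> irreducibles (simis_cone C \<inter> integer_points) \<longleftrightarrow>
      indecomposable (induced C {i. a $ i = 1}) \<and> b = cover_number (induced C {i. a $ i = 1})"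
    by (rule char_vec_irreducible_iff[OF assms(1,2)])
  then show ?thesis
    using a by (simp add: hilbert_basis_simis_cone)
qed

end
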